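(* Let $\Delta=\mathrm{diag}(b_1,b_2,b_3)$ with $b_1,b_2,b_3$ distinct nonzero complex numbers, let $x,y\in\mathbb C$ with $xy\neq0$, and let $\mathcal L\subset M_3[\mathbb C]$ be the subspace with (canonical) basis $$L_1=\begin{bmatrix}1&0&0\\ x&0&0\\ y&0&0\end{bmatrix},\quad L_2=\begin{bmatrix}0&1&0\\ b_\Delta(3)x&x&0\\ b_\Delta(2)y&y&0\end{bmatrix},\quad Q_1=\begin{bmatrix}0&0&1\\ 0&0&0\\ 0&0&0\end{bmatrix},$$ $$Q_2=\begin{bmatrix}0&0&0\\ b_\Delta(3)/b_2&b_\Delta(3)&1\\ 0&0&0\end{bmatrix},\quad Q_3=\begin{bmatrix}0&0&0\\ 0&0&0\\ b_\Delta(2)/b_3&b_\Delta(2)&1\end{bmatrix}.$$ Then $\mathcal L$ is transitive.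
   Context: $M_3[\mathbb C]$ is the space of $3\times3$ complex matrices. $b_\Delta(2)=\frac1{b_3}-\frac1{b_1}$, $b_\Delta(3)=\frac1{b_2}-\frac1{b_1}$. A subspace $\mathcal L\subset M_3[\mathbb C]$ is transitive if $\{Xv:X\in\mathcal L\}=\mathbb C^3$ for every nonzero $v\in\mathbb C^3$. *)

theory Defs
  imports "HOL-Analysis.Analysis"
begin

text \<open>The library provides the \<open>\<complex>\<close>-linear structure on vectors (\<open>*s\<close>, \<^locale>\<open>vector_space\<close>
  instance \<open>vec\<close>) but not on matrices, whose default \<open>span\<close> and \<open>subspace\<close> are the real ones.\<close>

definition matrix_scale :: "complex \<Rightarrow> complex^'n^'m \<Rightarrow> complex^'n^'m"  (infixr "*m" 75)
  where "c *m A = (\<chi> i j. c * A $ i $ j)"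

interpretation cmat: vector_space "matrix_scale :: complex \<Rightarrow> complex^'n^'m \<Rightarrow> complex^'n^'m"
  by unfold_locales (simp_all add: matrix_scale_def vec_eq_iff algebra_simps)

definition transitive_subspace :: "(complex^3^3) set \<Rightarrow> bool"
  where "transitive_subspace \<L> \<longleftrightarrow>
    cmat.subspace \<L> \<and> (\<forall>v :: complex^3. v \<noteq> 0 \<longrightarrow> {X *v v |X. X \<in> \<L>} = UNIV)"

definition diag3 :: "complex \<Rightarrow> complex \<Rightarrow> complex \<Rightarrow> complex^3^3"
  where "diag3 b1 b2 b3 = vector [vector [b1, 0, 0], vector [0, b2, 0], vector [0, 0, b3]]"

text \<open>Note the crossed indices: \<open>b\<^sub>\<Delta>(2)\<close> uses the third diagonal entry, \<open>b\<^sub>\<Delta>(3)\<close> the second.\<close>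

definition b\<Delta>2 :: "complex^3^3 \<Rightarrow> complex"
  where "b\<Delta>2 \<Delta> = 1 / \<Delta> $ 3 $ 3 - 1 / \<Delta> $ 1 $ 1"

definition b\<Delta>3 :: "complex^3^3 \<Rightarrow> complex"
  where "b\<Delta>3 \<Delta> = 1 / \<Delta> $ 2 $ 2 - 1 / \<Delta> $ 1 $ 1"

definition L1 :: "complex \<Rightarrow> complex \<Rightarrow> complex^3^3"
  where "L1 x y = vector [vector [1, 0, 0], vector [x, 0, 0], vector [y, 0, 0]]"

definition L2 :: "complex^3^3 \<Rightarrow> complex \<Rightarrow> complex \<Rightarrow> complex^3^3"
  where "L2 \<Delta> x y =
    vector [vector [0, 1, 0], vector [b\<Delta>3 \<Delta> * x, x, 0], vector [b\<Delta>2 \<Delta> * y, y, 0]]"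

definition Q1 :: "complex^3^3"
  where "Q1 = vector [vector [0, 0, 1], vector [0, 0, 0], vector [0, 0, 0]]"

definition Q2 :: "complex^3^3 \<Rightarrow> complex^3^3"
  where "Q2 \<Delta> =
    vector [vector [0, 0, 0], vector [b\<Delta>3 \<Delta> / \<Delta> $ 2 $ 2, b\<Delta>3 \<Delta>, 1], vector [0, 0, 0]]"

definition Q3 :: "complex^3^3 \<Rightarrow> complex^3^3"
  where "Q3 \<Delta> =
    vector [vector [0, 0, 0], vector [0, 0, 0], vector [b\<Delta>2 \<Delta> / \<Delta> $ 3 $ 3, b\<Delta>2 \<Delta>, 1]]"

text \<open>The five matrices are distinct and linearly independent for all parameter values, so they
  form a basis of their span.\<close>

lemma generators_distinct: "distinct [L1 x y, L2 \<Delta> x y, Q1, Q2 \<Delta>, Q3 \<Delta>]"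
  by (auto simp: L1_def L2_def Q1_def Q2_def Q3_def vec_eq_iff forall_3)

lemma generators_independent: "cmat.independent {L1 x y, L2 \<Delta> x y, Q1, Q2 \<Delta>, Q3 \<Delta>}"
proof (rule cmat.independent_if_scalars_zero)
  fix f A
  assume sum0: "(\<Sum>A\<in>{L1 x y, L2 \<Delta> x y, Q1, Q2 \<Delta>, Q3 \<Delta>}. f A *m A) = 0"
    and A: "A \<in> {L1 x y, L2 \<Delta> x y, Q1, Q2 \<Delta>, Q3 \<Delta>}"
  have "f (L1 x y) *m L1 x y + (f (L2 \<Delta> x y) *m L2 \<Delta> x y + (f Q1 *m Q1
      + (f (Q2 \<Delta>) *m Q2 \<Delta> + f (Q3 \<Delta>) *m Q3 \<Delta>))) = 0"
    using sum0 generators_distinct[of x y \<Delta>] by simp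
  then have "f (L1 x y) = 0 \<and> f (L2 \<Delta> x y) = 0 \<and> f Q1 = 0 \<and> f (Q2 \<Delta>) = 0 \<and> f (Q3 \<Delta>) = 0"
    by (simp add: matrix_scale_def vec_eq_iff forall_3)
      (simp add: L1_def L2_def Q1_def Q2_def Q3_def)
  then show "f A = 0"
    using A by auto
qed simp

end

theory Submission
  imports Defs
begin

text \<open>Let \<open>v = (v\<^sub>1, v\<^sub>2, v\<^sub>3)\<close>, \<open>p = b\<^sub>\<Delta>(3)\<close>, \<open>q = b\<^sub>\<Delta>(2)\<close>. The vectors \<open>Q\<^sub>1v\<close>, \<open>Q\<^sub>2v\<close>, \<open>Q\<^sub>3v\<close> are
  multiples of the unit vectors, with factors \<open>v\<^sub>3\<close>, \<open>p v\<^sub>1/b\<^sub>2 + p v\<^sub>2 + v\<^sub>3\<close> and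
  \<open>q v\<^sub>1/b\<^sub>3 + q v\<^sub>2 + v\<^sub>3\<close>, so only the coordinates with vanishing factor constrain the combination
  \<open>a L\<^sub>1v + b L\<^sub>2v = (s, x (s + p t), y (s + q t))\<close>, where \<open>s = a v\<^sub>1 + b v\<^sub>2\<close> and \<open>t = b v\<^sub>1\<close>.
  The three factors cannot vanish together. If \<open>v\<^sub>1 \<noteq> 0\<close>, then \<open>(s, t)\<close> is arbitrary and any two of
  the constraints can be met, because \<open>0\<close>, \<open>p\<close>, \<open>q\<close> are distinct; if \<open>v\<^sub>1 = 0\<close>, then at most one
  factor vanishes and \<open>s\<close> can be adjusted to it through \<open>v\<^sub>2 \<noteq> 0\<close>.\<close>

lemma two_of_three_forms:
  fixes p q k l m :: "'a :: field"
  assumes "p \<noteq> 0" "q \<noteq> 0" "p \<noteq> q" "\<not> (A \<and> B \<and> C)"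
  obtains s t where "A \<Longrightarrow> s = k" "B \<Longrightarrow> s + p * t = l" "C \<Longrightarrow> s + q * t = m"
proof (cases A)
  case True
  then show ?thesis
    using that[of k "(l - k) / p"] that[of k "(m - k) / q"] assms by (cases B) auto
next
  case False
  define t where "t = (l - m) / (p - q)"
  have "(p - q) * t = l - m"
    using assms by (simp add: t_def)
  then show ?thesis
    using that[of "l - p * t" t] False by (auto simp: algebra_simps)
qed

text \<open>These are the coordinates of \<open>X *v v = z\<close>, with \<beta> and \<gamma>
  standing for \<open>1 / b2\<close> and \<open>1 / b3\<close>.\<close>

lemma system_solvable:
  fixes x y p q \<beta> \<gamma> v1 v2 v3 z1 z2 z3 :: "'a :: field"
  assumes xy: "x \<noteq> 0" "y \<noteq> 0" and pq: "p \<noteq> 0" "q \<noteq> 0" "p \<noteq> q" and "\<beta> \<noteq> \<gamma>"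
    and v: "v1 \<noteq> 0 \<or> v2 \<noteq> 0 \<or> v3 \<noteq> 0"
  shows "\<exists>a b c d e. a * v1 + b * v2 + c * v3 = z1
    \<and> a * (x * v1) + b * (p * x * v1 + x * v2) + d * (p * \<beta> * v1 + p * v2 + v3) = z2
    \<and> a * (y * v1) + b * (q * y * v1 + y * v2) + e * (q * \<gamma> * v1 + q * v2 + v3) = z3"
proof -
  define f where "f = p * \<beta> * v1 + p * v2 + v3"
  define g where "g = q * \<gamma> * v1 + q * v2 + v3"
  obtain a b where ab: "v3 = 0 \<Longrightarrow> a * v1 + b * v2 = z1"
    "f = 0 \<Longrightarrow> a * v1 + b * v2 + p * (b * v1) = z2 / x"
    "g = 0 \<Longrightarrow> a * v1 + b * v2 + q * (b * v1) = z3 / y"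
  proof (cases "v1 = 0")
    case True
    \<comment> \<open>For \<open>v2 \<noteq> 0\<close> the order of the tests is immaterial, as at
      most one succeeds. For \<open>v2 = 0\<close> all three factors equal
      \<open>v3 \<noteq> 0\<close>, so the default 0 applies.\<close>
    define s where "s = (if v3 = 0 then z1 else if f = 0 then z2 / x else if g = 0 then z3 / y else 0)"
    have "v2 = 0 \<Longrightarrow> s = 0"
      using True v by (simp add: s_def f_def g_def)
    moreover have "f = 0 \<Longrightarrow> s = z2 / x" "g = 0 \<Longrightarrow> s = z3 / y"
      using True v pq by (auto simp: s_def f_def g_def add_eq_0_iff)
    moreover have "v3 = 0 \<Longrightarrow> s = z1"
      by (simp add: s_def)
    ultimately show ?thesis
      using that[of 0 "s / v2"] True by (cases "v2 = 0") auto
  next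
    case False
    have "\<not> (v3 = 0 \<and> f = 0 \<and> g = 0)"
    proof
      assume "v3 = 0 \<and> f = 0 \<and> g = 0"
      then have "p * (\<beta> * v1 + v2) = 0" "q * (\<gamma> * v1 + v2) = 0"
        by (auto simp: f_def g_def distrib_left mult.assoc)
      then have "\<beta> * v1 + v2 = \<gamma> * v1 + v2"
        using pq by simp
      then show False
        using False \<open>\<beta> \<noteq> \<gamma>\<close> by simp
    qed
    then obtain s t where "v3 = 0 \<Longrightarrow> s = z1" "f = 0 \<Longrightarrow> s + p * t = z2 / x"
      "g = 0 \<Longrightarrow> s + q * t = z3 / y"
      using two_of_three_forms[OF pq] by metis
    then show ?thesis
      \<comment> \<open>Solves \<open>s = a * v1 + b * v2\<close>, \<open>t = b * v1\<close> for
        \<open>a\<close>, \<open>b\<close>.\<close>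
      using that[of "(s - t / v1 * v2) / v1" "t / v1"] False by simp
  qed
  define h where "h = a * v1 + b * v2"
  \<comment> \<open>If the factor is 0, the quotient is 0 by convention and \<open>ab\<close> gives
    the equation.\<close>
  have "h + (z1 - h) / v3 * v3 = z1"
    using ab(1) by (cases "v3 = 0") (auto simp: h_def)
  moreover have "x * (h + p * (b * v1)) + (z2 - x * (h + p * (b * v1))) / f * f = z2"
    using ab(2) xy by (cases "f = 0") (auto simp: h_def)
  moreover have "y * (h + q * (b * v1)) + (z3 - y * (h + q * (b * v1))) / g * g = z3"
    using ab(3) xy by (cases "g = 0") (auto simp: h_def)
  ultimately obtain c d e where "h + c * v3 = z1" "x * (h + p * (b * v1)) + d * f = z2"
    "y * (h + q * (b * v1)) + e * g = z3"
    by blast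
  then show ?thesis
    unfolding f_def g_def h_def
    by (intro exI[of _ a] exI[of _ b] exI[of _ c] exI[of _ d] exI[of _ e]) (simp add: algebra_simps)
qed

theorem proposition42:
  fixes \<Delta> :: "complex^3^3" and b1 b2 b3 x y :: complex and \<L> :: "(complex^3^3) set"
  assumes "\<Delta> = diag3 b1 b2 b3"
    and "distinct [b1, b2, b3]"
    and "b1 \<noteq> 0" "b2 \<noteq> 0" "b3 \<noteq> 0"
    and "x * y \<noteq> 0"
    and "\<L> = cmat.span {L1 x y, L2 \<Delta> x y, Q1, Q2 \<Delta>, Q3 \<Delta>}"
  shows "transitive_subspace \<L>"
proof -
  define p q where "p = b\<Delta>3 \<Delta>" and "q = b\<Delta>2 \<Delta>"
  have diag: "\<Delta> $ 1 $ 1 = b1" "\<Delta> $ 2 $ 2 = b2" "\<Delta> $ 3 $ 3 = b3"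
    using assms(1) by (simp_all add: diag3_def)
  have pq: "p \<noteq> 0" "q \<noteq> 0" "p \<noteq> q"
    using assms(2-5) by (auto simp: p_def q_def b\<Delta>2_def b\<Delta>3_def diag)
  have "\<exists>X\<in>\<L>. X *v v = z" if "v \<noteq> 0" for v z :: "complex^3"
  proof -
    have "v $ 1 \<noteq> 0 \<or> v $ 2 \<noteq> 0 \<or> v $ 3 \<noteq> 0"
      using that by (simp add: vec_eq_iff forall_3)
    moreover have "1 / b2 \<noteq> 1 / b3"
      using assms(2) by simp
    ultimately obtain a b c d e where abcde:
      "a * v $ 1 + b * v $ 2 + c * v $ 3 = z $ 1"
      "a * (x * v $ 1) + b * (p * x * v $ 1 + x * v $ 2)
        + d * (p * (1 / b2) * v $ 1 + p * v $ 2 + v $ 3) = z $ 2"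
      "a * (y * v $ 1) + b * (q * y * v $ 1 + y * v $ 2)
        + e * (q * (1 / b3) * v $ 1 + q * v $ 2 + v $ 3) = z $ 3"
      using system_solvable[of x y p q "1 / b2" "1 / b3" "v $ 1" "v $ 2" "v $ 3" "z $ 1" "z $ 2" "z $ 3"]
        pq assms(6) by auto
    define X where
      "X = a *m L1 x y + b *m L2 \<Delta> x y + c *m Q1 + d *m Q2 \<Delta> + e *m Q3 \<Delta>"
    have "X \<in> \<L>"
      unfolding X_def assms(7) by (intro cmat.span_add cmat.span_scale cmat.span_base) auto
    moreover have "X *v v = z"
      unfolding vec_eq_iff forall_3 abcde[symmetric]
      by (simp add: X_def matrix_vector_mult_def sum_3 matrix_scale_def
          L1_def L2_def Q1_def Q2_def Q3_def diag distrib_left distrib_right flip: p_def q_def)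
    ultimately show ?thesis ..
  qed
  moreover have "cmat.subspace \<L>"
    by (simp add: assms(7))
  ultimately show ?thesis
    by (simp add: transitive_subspace_def set_eq_iff) metis
qed

end
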